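(* Let $K\subset L$ be a field extension and let $A$, $B$ be two $n$-dimensional $K$-subspaces of $L$ with $n>1$. If $A$ is matched to $B$, then $A$ is weakly locally matched to $B$.
   Context: Let $A,B$ be $n$-dimensional $K$-subspaces of $L$. An ordered basis $\{a_1,\ldots,a_n\}$ of $A$ is matched to an ordered basis $\{b_1,\ldots,b_n\}$ of $B$ if $a_i^{-1}A\cap B\subset\langle b_1,\ldots,\hat{b}_i,\ldots,b_n\rangle$ for each $1\le i\le n$, where $\langle b_1,\ldots,\hat b_i,\ldots,b_n\rangle$ is the $K$-span of $\{b_1,\ldots,b_n\}\setminus\{b_i\}$. The subspace $A$ is matched to $B$ if every ordered basis of $A$ can be matched to some ordered basis of $B$. Let $\tilde A\subset A$ and $\tilde B\subset B$ be $K$-subspaces of the same dimension $m$. We say $\tilde A$ is weakly $A$-matched to $\tilde B$ if there exist ordered bases $\{a_1,\ldots,a_m\}$ of $\tilde A$ and $\{b_1,\ldots,b_m\}$ of $\tilde B$ such that $a_ib_i\notin A$ for $i=1,\ldots,m$. We say $A$ is weakly locally matched to $B$ if for any intermediate field $K\subset H\subsetneqq L$ with $H\cap B\neq\{0\}$ and $aH\subset A$ for some $a\in A$, one can find a $K$-subspace $\tilde A$ of $A$ (with $\dim_K\tilde A=\dim_K(H\cap B)$) such that $\tilde A$ is weakly $A$-matched to $H\cap B$. *)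

theory Defs
  imports "HOL-Algebra.Embedded_Algebras"
begin

text \<open>
  Below, \<open>K\<close> is a subfield of the ambient field. A set \<open>E\<close> with \<open>dimension n K E\<close> is
  automatically a \<open>K\<close>-subspace of the ambient field, and \<open>independent K us\<close> forces the list
  \<open>us\<close> to be distinct and contained in the carrier.
\<close>

context field
begin

definition ordered_basis :: "'a set \<Rightarrow> 'a set \<Rightarrow> 'a list \<Rightarrow> bool"
  where "ordered_basis K E us \<longleftrightarrow> independent K us \<and> Span K us = E"

definition basis_matched :: "'a set \<Rightarrow> 'a set \<Rightarrow> 'a set \<Rightarrow> 'a list \<Rightarrow> 'a list \<Rightarrow> bool"
  where "basis_matched K A B as bs \<longleftrightarrow>
    (\<forall>i < length as. (inv (as ! i) <# A) \<inter> B \<subseteq> Span K (take i bs @ drop (Suc i) bs))"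

definition matched :: "'a set \<Rightarrow> 'a set \<Rightarrow> 'a set \<Rightarrow> bool"
  where "matched K A B \<longleftrightarrow>
    (\<forall>as. ordered_basis K A as \<longrightarrow> (\<exists>bs. ordered_basis K B bs \<and> basis_matched K A B as bs))"

definition weakly_matched :: "'a set \<Rightarrow> 'a set \<Rightarrow> 'a set \<Rightarrow> 'a set \<Rightarrow> bool"
  where "weakly_matched K A A' B' \<longleftrightarrow>
    (\<exists>as bs. ordered_basis K A' as \<and> ordered_basis K B' bs \<and> length as = length bs \<and>
      (\<forall>i < length as. as ! i \<otimes> bs ! i \<notin> A))"

text \<open>As in the source, the witness \<open>a \<in> A\<close> for \<open>a <# H \<subseteq> A\<close> is not required to be nonzero.\<close>

definition weakly_locally_matched :: "'a set \<Rightarrow> 'a set \<Rightarrow> 'a set \<Rightarrow> bool"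
  where "weakly_locally_matched K A B \<longleftrightarrow>
    (\<forall>H. subfield H R \<and> K \<subseteq> H \<and> H \<subset> carrier R \<and> H \<inter> B \<noteq> {\<zero>} \<and> (\<exists>a \<in> A. a <# H \<subseteq> A) \<longrightarrow>
      (\<exists>A' m. A' \<subseteq> A \<and> dimension m K A' \<and> dimension m K (H \<inter> B) \<and>
        weakly_matched K A A' (H \<inter> B)))"

end

end

theory Submission
  imports Defs
begin

text \<open>
  Suppose a basis \<open>as\<close> of \<open>A\<close> is matched to a basis \<open>bs\<close> of \<open>B\<close>. If \<open>w \<in> B\<close> has nonzero
  \<open>i\<close>-th coordinate with respect to \<open>bs\<close>, then \<open>as ! i \<otimes> w \<notin> A\<close>. Now let \<open>W\<close> be any subspace
  of \<open>B\<close>, of dimension \<open>m\<close>. By Gaussian elimination there are a basis \<open>w\<^sub>1, \<dots>, w\<^sub>m\<close> of \<open>W\<close> and distinct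
  indices \<open>i\<^sub>1, \<dots>, i\<^sub>m\<close> such that \<open>w\<^sub>j\<close> has nonzero \<open>i\<^sub>j\<close>-th coordinate, so the span of the
  corresponding \<open>as ! i\<^sub>j\<close> is weakly \<open>A\<close>-matched to \<open>W\<close>.
  For the theorem take \<open>W = H \<inter> B\<close>.
\<close>

section \<open>Elimination in spans over a subfield\<close>

context ring
begin

lemma independent_zero_notin:
  assumes "subfield K R" "independent K us"
  shows "\<zero> \<notin> set us"
  using assms(2)
proof (induct us rule: list.induct)
  case (Cons u us)
  note u = independent_backwards[OF Cons(2)]
  have "\<zero> \<in> Span K us"
    using Span_subgroup_props(2)[OF assms(1) independent_in_carrier[OF u(2)]] .
  with u(1) Cons(1)[OF u(2)] show ?case
    by auto
qed simp

text \<open>If \<open>k \<otimes> b \<oplus> v\<close> and \<open>v\<close> both lie in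
  \<open>Span K bs\<close>, so does \<open>k \<otimes> b\<close>, and a nonzero \<open>k\<close>
  would put \<open>b\<close> there too. In the induction below this keeps a nonzero coordinate
  nonzero when the basis grows by \<open>b\<close>.\<close>

lemma Span_Cons_inter_Span:
  assumes K: "subfield K R" and bs: "set bs \<subseteq> carrier R" and cs: "set cs \<subseteq> set bs"
    and b: "b \<in> carrier R" "b \<notin> Span K bs"
  shows "Span K (b # cs) \<inter> Span K bs \<subseteq> Span K cs"
proof
  fix w assume "w \<in> Span K (b # cs) \<inter> Span K bs"
  then obtain k v where k: "k \<in> K" and v: "v \<in> Span K cs"
    and w: "w = k \<otimes> b \<oplus> v" "w \<in> Span K bs"
    by (auto simp: line_extension_mem_iff)
  have kc: "k \<in> carrier R"
    using k subfieldE(3)[OF K] by auto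
  have v_bs: "v \<in> Span K bs"
    using v mono_Span_subset[OF K _ bs] cs Span_base_incl[OF K bs] by blast
  have vc: "v \<in> carrier R"
    using v_bs Span_subgroup_props(1)[OF K bs] by auto
  have "w \<oplus> \<ominus> v \<in> Span K bs"
    using w(2) v_bs Span_subgroup_props(3,4)[OF K bs] by simp
  moreover have "w \<oplus> \<ominus> v = k \<otimes> b"
    using w(1) kc b(1) vc by (simp add: a_assoc r_neg)
  ultimately have "k \<otimes> b \<in> Span K bs"
    by simp
  hence "k = \<zero>"
    using Span_m_inv_simprule[OF K bs, of k b] k b by auto
  thus "w \<in> Span K cs"
    using w(1) v b(1) vc by simp
qed

text \<open>One elimination step: \<open>w\<close> has a nonzero \<open>b\<close>-coordinate, so
  every element of \<open>W\<close> can be moved into \<open>W \<inter> Span K bs\<close> by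
  subtracting a multiple of \<open>w\<close>.\<close>

lemma subalgebra_eq_Span_Cons:
  assumes K: "subfield K R" and bs: "set bs \<subseteq> carrier R" and b: "b \<in> carrier R"
    and W: "subalgebra K W R" "W \<subseteq> Span K (b # bs)"
    and w: "w \<in> W" "w \<notin> Span K bs"
    and ws: "Span K ws = W \<inter> Span K bs"
  shows "Span K (w # ws) = W"
proof -
  have Kc: "K \<subseteq> carrier R" and Wc: "W \<subseteq> carrier R" and Sc: "Span K bs \<subseteq> carrier R"
    using subfieldE(3)[OF K] subalgebra_in_carrier[OF W(1)] Span_subgroup_props(1)[OF K bs]
    by auto
  have W_add: "x \<oplus> y \<in> W" if "x \<in> W" "y \<in> W" for x y
    using subgroup.m_closed[OF subalgebra.axioms(1)[OF W(1)]] that by simp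
  have W_minus: "\<ominus> x \<in> W" if "x \<in> W" for x
    using add.subgroupE(3)[OF subalgebra.axioms(1)[OF W(1)]] that by simp
  have W_smult: "c \<otimes> x \<in> W" if "c \<in> K" "x \<in> W" for c x
    using subalgebra.smult_closed[OF W(1)] that by simp
  obtain k s where k: "k \<in> K" and s: "s \<in> Span K bs" and w_eq: "w = k \<otimes> b \<oplus> s"
    using subsetD[OF W(2) w(1)] by (auto simp: line_extension_mem_iff)
  have "k \<noteq> \<zero>"
    using w(2) s w_eq b Sc by auto
  hence inv_k: "inv k \<in> K" "inv k \<otimes> k = \<one>"
    using subfield_m_inv[OF K, of k] k by auto
  have "W \<subseteq> Span K (w # ws)"
  proof
    fix x assume x: "x \<in> W"
    then obtain k' s' where k': "k' \<in> K" and s': "s' \<in> Span K bs" and x_eq: "x = k' \<otimes> b \<oplus> s'"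
      using subsetD[OF W(2) x] by (auto simp: line_extension_mem_iff)
    \<comment> \<open>With this factor \<open>c \<otimes> w\<close> and \<open>x\<close> have the
      same \<open>b\<close>-coordinate, so it cancels in their difference.\<close>
    define c where "c = k' \<otimes> inv k"
    have c: "c \<in> K"
      unfolding c_def using k' inv_k(1) subringE(6)[OF subfieldE(1)[OF K]] by simp
    have mem: "c \<in> carrier R" "k \<in> carrier R" "k' \<in> carrier R" "s \<in> carrier R" "s' \<in> carrier R"
        "w \<in> carrier R" "x \<in> carrier R" "inv k \<in> carrier R"
      using c k k' s s' w(1) x inv_k(1) Kc Sc Wc by auto
    have "c \<otimes> k = k'"
      unfolding c_def using mem inv_k(2) by (simp add: m_assoc)
    hence "c \<otimes> w = k' \<otimes> b \<oplus> c \<otimes> s"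
      unfolding w_eq using mem b by (simp add: r_distr flip: m_assoc)
    hence "x \<oplus> \<ominus> (c \<otimes> w) = s' \<oplus> \<ominus> (c \<otimes> s)"
      unfolding x_eq using mem b
      by (simp add: minus_add a_ac r_neg r_neg1 r_neg2)
    moreover have "s' \<oplus> \<ominus> (c \<otimes> s) \<in> Span K bs"
      using s s' c Span_subgroup_props(3,4)[OF K bs] Span_smult_closed[OF K bs] by simp
    moreover have "x \<oplus> \<ominus> (c \<otimes> w) \<in> W"
      using x c w(1) W_add W_minus W_smult by simp
    ultimately have "x \<oplus> \<ominus> (c \<otimes> w) \<in> Span K ws"
      using ws by simp
    moreover have "x = c \<otimes> w \<oplus> (x \<oplus> \<ominus> (c \<otimes> w))"
      using mem by (simp add: a_lcomm[of "c \<otimes> w"] r_neg)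
    ultimately show "x \<in> Span K (w # ws)"
      using c by (auto simp: line_extension_mem_iff)
  qed
  moreover have "Span K (w # ws) \<subseteq> W"
    using ws w(1) W_add W_smult by (auto simp: line_extension_mem_iff)
  ultimately show ?thesis
    by auto
qed

text \<open>Independence of \<open>us\<close> encodes that the selected coordinates are pairwise distinct.\<close>

lemma exists_transversal_bases:
  assumes K: "subfield K R" and "length as = length bs"
    and "independent K as" "independent K bs"
    and "subalgebra K W R" "W \<subseteq> Span K bs"
  shows "\<exists>us ws. independent K us \<and> set us \<subseteq> set as \<and> independent K ws \<and> Span K ws = W \<and>
    list_all2 (\<lambda>u w. \<exists>i < length as. u = as ! i \<and> w \<notin> Span K (take i bs @ drop (Suc i) bs)) us ws"
  using assms(2-)
\<comment> \<open>\<open>W\<close> must vary, since the hypothesis is applied to the smaller space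
  \<open>W \<inter> Span K bs\<close>.\<close>
proof (induct as bs arbitrary: W rule: list_induct2)
  case Nil
  have "\<zero> \<in> W"
    using subgroup.one_closed[OF subalgebra.axioms(1)[OF Nil(3)]] by simp
  hence "Span K [] = W"
    using Nil(4) by auto
  thus ?case
    by (intro exI[of _ "[]"]) auto
next
  case (Cons a as b bs)
  note a = independent_backwards[OF Cons(3)] and b = independent_backwards[OF Cons(4)]
  have asc: "set as \<subseteq> carrier R" and bsc: "set bs \<subseteq> carrier R"
    using independent_in_carrier a(2) b(2) by auto
  define W' where "W' = W \<inter> Span K bs"
  have "subalgebra K W' R" "W' \<subseteq> Span K bs"
    unfolding W'_def using subalgebra_inter[OF Cons(5) Span_is_subalgebra[OF K bsc]] by auto
  from Cons(2)[OF a(2) b(2) this] obtain us ws where us: "independent K us" "set us \<subseteq> set as"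
    and ws: "independent K ws" "Span K ws = W'"
    and sel: "list_all2 (\<lambda>u w. \<exists>i < length as. u = as ! i \<and>
                w \<notin> Span K (take i bs @ drop (Suc i) bs)) us ws"
    by blast
  have wsc: "set ws \<subseteq> W'"
    using Span_base_incl[OF K independent_in_carrier[OF ws(1)]] ws(2) by simp
  have sel': "list_all2 (\<lambda>u w. \<exists>i < length (a # as). u = (a # as) ! i \<and>
                w \<notin> Span K (take i (b # bs) @ drop (Suc i) (b # bs))) us ws"
  \<comment> \<open>This rule also supplies \<open>w \<in> set ws\<close>, hence
    \<open>w \<in> Span K bs\<close>. Index \<open>i\<close> for \<open>bs\<close> becomes
    \<open>Suc i\<close> for \<open>b # bs\<close>, where the list of the other basis vectors gains
    \<open>b\<close>.\<close>
  proof (rule list.rel_mono_strong[OF sel])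
    fix u w assume "w \<in> set ws"
      and "\<exists>i < length as. u = as ! i \<and> w \<notin> Span K (take i bs @ drop (Suc i) bs)"
    then obtain i where i: "i < length as" "u = as ! i"
        "w \<notin> Span K (take i bs @ drop (Suc i) bs)" and w: "w \<in> Span K bs"
      using wsc W'_def by auto
    have "set (take i bs @ drop (Suc i) bs) \<subseteq> set bs"
      by (auto dest: in_set_takeD in_set_dropD)
    from Span_Cons_inter_Span[OF K bsc this b(3,1)] i(3) w
    have "w \<notin> Span K (b # take i bs @ drop (Suc i) bs)"
      by blast
    thus "\<exists>i < length (a # as). u = (a # as) ! i \<and>
            w \<notin> Span K (take i (b # bs) @ drop (Suc i) (b # bs))"
      using i(1,2) by (intro exI[of _ "Suc i"]) simp
  qed
  show ?case
  \<comment> \<open>If equality holds, no element of \<open>W\<close> has a nonzero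
    \<open>b\<close>-coordinate and index 0 stays unselected. Otherwise some \<open>w\<close> has
    one, and it is paired with \<open>a\<close>.\<close>
  proof (cases "W' = W")
    case True
    with us ws sel' show ?thesis
      by (intro exI[of _ us] exI[of _ ws]) auto
  next
    case False
    then obtain w where w: "w \<in> W" "w \<notin> Span K bs"
      unfolding W'_def by auto
    have "Span K us \<subseteq> Span K as"
      using us(2) mono_Span_subset[OF K _ asc] Span_base_incl[OF K asc] by blast
    hence "independent K (a # us)"
      using a us(1) by (intro li_Cons) auto
    moreover have "independent K (w # ws)"
      using w ws subalgebra_in_carrier[OF Cons(5)] by (intro li_Cons) (auto simp: W'_def)
    moreover have "Span K (w # ws) = W"
      using subalgebra_eq_Span_Cons[OF K bsc b(3) Cons(5,6) w] ws(2) W'_def by simp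
    \<comment> \<open>For the new pair the index is 0: removing \<open>b\<close> from
      \<open>b # bs\<close> leaves \<open>bs\<close>, and \<open>w\<close> avoids its span.\<close>
    moreover have "list_all2 (\<lambda>u w. \<exists>i < length (a # as). u = (a # as) ! i \<and>
        w \<notin> Span K (take i (b # bs) @ drop (Suc i) (b # bs))) (a # us) (w # ws)"
      using w(2) sel' by (auto intro!: exI[of _ 0])
    ultimately show ?thesis
      using us(2) by (intro exI[of _ "a # us"] exI[of _ "w # ws"]) auto
  qed
qed

end

section \<open>From matched bases to weakly matched subspaces\<close>

context field
begin

text \<open>Contrapositive of the matching condition: if the product were in \<open>A\<close>,
  dividing by \<open>as ! i\<close> would put \<open>w\<close> in
  \<open>(inv (as ! i) <# A) \<inter> B\<close>.\<close>

lemma basis_matched_mult_notin: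
  assumes "basis_matched K A B as bs" "A \<subseteq> carrier R" "i < length as"
    and "as ! i \<in> carrier R - {\<zero>}" "w \<in> B" "w \<in> carrier R"
    and "w \<notin> Span K (take i bs @ drop (Suc i) bs)"
  shows "as ! i \<otimes> w \<notin> A"
proof
  assume "as ! i \<otimes> w \<in> A"
  moreover have "w = inv (as ! i) \<otimes> (as ! i \<otimes> w)"
    using assms(4,6) by (simp add: field_Units flip: m_assoc)
  ultimately have "w \<in> inv (as ! i) <# A"
    unfolding l_coset_def by blast
  with assms show False
    unfolding basis_matched_def by blast
qed

lemma matched_imp_weakly_matched_subspace:
  assumes K: "subfield K R" and A: "dimension n K A" and B: "dimension n K B"
    and AB: "matched K A B" and W: "subalgebra K W R" "W \<subseteq> B"
  obtains A' m where "A' \<subseteq> A" "dimension m K A'" "dimension m K W" "weakly_matched K A A' W"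
proof -
  obtain as where as: "independent K as" "length as = n" "Span K as = A"
    using exists_base[OF K A] by blast
  then obtain bs where bs: "independent K bs" "Span K bs = B" and m: "basis_matched K A B as bs"
    using AB unfolding matched_def ordered_basis_def by blast
  \<comment> \<open>The bases of \<open>A\<close> and \<open>B\<close> thus have equal length, so
    they can be indexed together.\<close>
  have "length bs = n"
    using dimension_is_inj[OF K dimensionI[OF K bs] B] .
  then obtain us ws where us: "independent K us" "set us \<subseteq> set as"
    and ws: "independent K ws" "Span K ws = W"
    and sel: "list_all2 (\<lambda>u w. \<exists>i < length as. u = as ! i \<and>
                w \<notin> Span K (take i bs @ drop (Suc i) bs)) us ws"
    using exists_transversal_bases[OF K _ as(1) bs(1) W(1)] as(2) W(2) bs(2) by auto
  have asc: "set as \<subseteq> carrier R" and wsc: "set ws \<subseteq> carrier R"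
    using independent_in_carrier as(1) ws(1) by auto
  have Ac: "A \<subseteq> carrier R"
    using space_subgroup_props(1)[OF K A] .
  have len: "length us = length ws"
    using sel by (rule list_all2_lengthD)
  have notin: "us ! j \<otimes> ws ! j \<notin> A" if j: "j < length us" for j
  proof -
    obtain i where i: "i < length as" "us ! j = as ! i"
        "ws ! j \<notin> Span K (take i bs @ drop (Suc i) bs)"
      using list_all2_nthD[OF sel j] by blast
    have "ws ! j \<in> set ws"
      using j len by simp
    moreover from this have "ws ! j \<in> B"
      using Span_base_incl[OF K wsc] ws(2) W(2) by auto
    moreover have "\<zero> \<notin> set as"
      using independent_zero_notin[OF K as(1)] .
    ultimately show ?thesis
      using basis_matched_mult_notin[OF m Ac i(1) _ _ _ i(3)] i(1,2) asc wsc
      by (metis Diff_iff nth_mem singletonD subsetD)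
  qed
  show thesis
  proof
    show "Span K us \<subseteq> A"
      using us(2) mono_Span_subset[OF K _ asc] Span_base_incl[OF K asc] as(3) by blast
    show "dimension (length us) K (Span K us)"
      using dimension_independent[OF us(1)] .
    show "dimension (length us) K W"
      using dimensionI[OF K ws] len by simp
    show "weakly_matched K A (Span K us) W"
      unfolding weakly_matched_def ordered_basis_def using us(1) ws len notin by blast
  qed
qed

lemma matched_imp_weakly_locally_matched:
  assumes K: "subfield K R" and A: "dimension n K A" and B: "dimension n K B"
    and AB: "matched K A B"
  shows "weakly_locally_matched K A B"
  unfolding weakly_locally_matched_def
proof (intro allI impI, elim conjE)
  fix H assume H: "subfield H R" "K \<subseteq> H"
  \<comment> \<open>Since \<open>K \<subseteq> H\<close>, multiplication in \<open>H\<close>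
    restricts to scalar multiplication by \<open>K\<close>, so \<open>H \<inter> B\<close> is a
    \<open>K\<close>-subspace of \<open>B\<close>.\<close>
  have "subalgebra K H R"
    using subring.axioms(1)[OF subfieldE(1)[OF H(1)]] subringE(6)[OF subfieldE(1)[OF H(1)]] H(2)
    unfolding subalgebra_def subalgebra_axioms_def by blast
  hence "subalgebra K (H \<inter> B) R"
    using subalgebra_inter finite_dimension_imp_subalgebra[OF K finite_dimensionI[OF B]] by blast
  from matched_imp_weakly_matched_subspace[OF K A B AB this] show
    "\<exists>A' m. A' \<subseteq> A \<and> dimension m K A' \<and> dimension m K (H \<inter> B) \<and> weakly_matched K A A' (H \<inter> B)"
    by (metis inf_le2)
qed

end

theorem theorem5:
  fixes L :: "('a, 'b) ring_scheme" and K A B :: "'a set" and n :: nat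
  assumes "field L"
    and "subfield K L"
    and "n > 1"
    and "ring.dimension L n K A"
    and "ring.dimension L n K B"
    and "field.matched L K A B"
  shows "field.weakly_locally_matched L K A B"
  using field.matched_imp_weakly_locally_matched[OF assms(1,2,4-6)] .

end
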